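(* Let $N\in\{2,3\}$, $g\in L^1([0,1])$, $\lambda\in\mathbb{R}$, and set $h_1(t)=e^{(N-3)t}\int_0^{e^{-t}}g(s)\,ds$ for $t\ge 0$. Suppose that $$\lambda h_1(t)\le\frac{N-1}{2}\qquad\text{for all } t>0.$$ Then the boundary value problem $$-w''+(N-2)w'+(N-1)w=\frac{N-1}{2}e^{-t}w^2+\lambda h_1(t)\quad (t>0),\qquad w'(0)-(N-1)w(0)=0,\quad \lim_{t\to\infty}w(t)=0,$$ has at least one solution $w:[0,\infty)\to\mathbb{R}$.
   Context: A solution is a function $w\in C^2([0,\infty))$ satisfying the equation pointwise together with the two boundary conditions (note that $h_1$ is continuous). *)

theory Defs
  imports "HOL-Analysis.Analysis"
begin

definition h1 :: "nat \<Rightarrow> (real \<Rightarrow> real) \<Rightarrow> real \<Rightarrow> real" where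
  "h1 N g t = exp ((real N - 3) * t) * (LINT s:{0..exp (- t)}|lebesgue. g s)"

text \<open>
  A solution is a function of class \<open>C\<^sup>2\<close> on the closed half-line, so the derivatives at 0
  are one-sided; they are taken within \<open>{0..}\<close> and hence depend only on the values of \<open>w\<close> there.
  The functions \<open>w'\<close> and \<open>w''\<close> are unique on \<open>{0..}\<close>.
\<close>

definition is_solution :: "nat \<Rightarrow> (real \<Rightarrow> real) \<Rightarrow> real \<Rightarrow> (real \<Rightarrow> real) \<Rightarrow> bool" where
  "is_solution N g lam w \<longleftrightarrow>
    (\<exists>w' w''.
      (\<forall>t\<ge>0. (w has_real_derivative w' t) (at t within {0..})) \<and>
      (\<forall>t\<ge>0. (w' has_real_derivative w'' t) (at t within {0..})) \<and>
      continuous_on {0..} w'' \<and>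
      (\<forall>t>0. - w'' t + (real N - 2) * w' t + (real N - 1) * w t =
              (real N - 1) / 2 * exp (- t) * (w t)\<^sup>2 + lam * h1 N g t) \<and>
      w' 0 - (real N - 1) * w 0 = 0 \<and>
      (w \<longlongrightarrow> 0) at_top)"

end

theory Submission
  imports Defs
begin

text \<open>
  Put \<open>m = N - 1\<close>. The constant \<open>1\<close> is a supersolution, because \<open>lam * h1 \<le> m / 2\<close>, and \<open>- A\<close> is a
  subsolution for large \<open>A\<close>. Adding \<open>m * A * w\<close> to both sides makes the right-hand side increasing
  in \<open>w\<close> on \<open>[- A, 1]\<close>, and the linear operator on the left has a positive Green kernel. Iterating
  from \<open>1\<close> gives a decreasing sequence, whose limit solves the integral equation by dominated
  convergence and is therefore a bounded C\<open>\<^sup>2\<close> solution. The forcing vanishes at infinity, and the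
  linear operator factors into the stable \<open>w' + w\<close> and the unstable \<open>w' - m * w\<close>, so a bounded
  solution tends to 0.
\<close>

section \<open>The Green operator\<close>

text \<open>Transfers one-sided calculus on compact intervals to the half-line: the two sets
  coincide near \<open>t\<close>.\<close>

lemma within_half_line:
  fixes t :: real
  assumes "t \<ge> 0"
  shows "at t within {0..t + 1} = at t within {0..}"
  by (rule at_within_nhd[of _ "{..<t + 1}"]) auto

locale green =
  fixes p q m :: real
  assumes p_pos: "0 < p" and m_pos: "0 < m" and m_le_q: "m \<le> q"
begin

lemma q_pos: "0 < q"
  using m_pos m_le_q by linarith

text \<open>Integrability is asked for instead of continuity because \<open>green_op\<close> is
  applied to the pointwise limit of the iterates before that limit is known to be
  continuous.\<close>

definition admissible :: "(real \<Rightarrow> real) \<Rightarrow> bool" where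
  "admissible f \<longleftrightarrow> (\<forall>t\<ge>0. (\<lambda>s. exp (p * s) * f s) integrable_on {0..t} \<and>
                           (\<lambda>s. exp (- q * s) * f s) integrable_on {t..})"

definition head :: "(real \<Rightarrow> real) \<Rightarrow> real \<Rightarrow> real" where
  "head f t = integral {0..t} (\<lambda>s. exp (p * s) * f s)"

definition tail :: "(real \<Rightarrow> real) \<Rightarrow> real \<Rightarrow> real" where
  "tail f t = integral {t..} (\<lambda>s. exp (- q * s) * f s)"

text \<open>
  The operator \<open>- u'' + (q - p) * u' + p * q * u\<close> has the homogeneous solutions \<open>exp (- p * t)\<close> and
  \<open>exp (q * t)\<close>. The coefficient of the first one is chosen to enforce \<open>u' 0 = m * u 0\<close>; the
  hypothesis \<open>m \<le> q\<close> makes it nonnegative, hence \<open>green_op\<close> monotone.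
\<close>

definition refl_coeff :: real where
  "refl_coeff = (q - m) / (p + m)"

definition green_op :: "(real \<Rightarrow> real) \<Rightarrow> real \<Rightarrow> real" where
  "green_op f t =
     (exp (- p * t) * (head f t + refl_coeff * tail f 0) + exp (q * t) * tail f t) / (p + q)"

definition green_deriv :: "(real \<Rightarrow> real) \<Rightarrow> real \<Rightarrow> real" where
  "green_deriv f t =
     (- p * exp (- p * t) * (head f t + refl_coeff * tail f 0) + q * exp (q * t) * tail f t) / (p + q)"

lemma refl_coeff_nonneg: "0 \<le> refl_coeff"
  using p_pos m_pos m_le_q by (simp add: refl_coeff_def)

lemma admissible_continuous:
  assumes cont: "continuous_on {0..} f" and bound: "\<And>t. t \<ge> 0 \<Longrightarrow> \<bar>f t\<bar> \<le> B"
  shows "admissible f"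
  unfolding admissible_def
proof (intro allI impI conjI)
  fix t :: real assume t: "t \<ge> 0"
  have c0: "continuous_on {0..t} f" and c1: "continuous_on {t..} f"
    by (auto intro: continuous_on_subset[OF cont] simp: t)
  show "(\<lambda>s. exp (p * s) * f s) integrable_on {0..t}"
    by (intro integrable_continuous_interval continuous_intros c0)
  show "(\<lambda>s. exp (- q * s) * f s) integrable_on {t..}"
  proof (rule measurable_bounded_by_integrable_imp_integrable)
    show "(\<lambda>s. exp (- q * s) * f s) \<in> borel_measurable (lebesgue_on {t..})"
      by (intro continuous_imp_measurable_on_sets_lebesgue continuous_intros c1) auto
    show "(\<lambda>s. exp (- q * s) * B) integrable_on {t..}"
      by (intro integrable_on_mult_left integrable_on_exp_minus_to_infinity q_pos)
    show "norm (exp (- q * s) * f s) \<le> exp (- q * s) * B" if "s \<in> {t..}" for s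
      using bound[of s] that t by (auto simp: abs_mult intro!: mult_left_mono)
  qed auto
qed

section \<open>Monotonicity, constant bounds and passage to the limit\<close>

lemma green_op_mono:
  assumes "admissible f" "admissible g" and le: "\<And>s. s \<ge> 0 \<Longrightarrow> f s \<le> g s" and t: "t \<ge> 0"
  shows "green_op f t \<le> green_op g t"
proof -
  have h: "head f t \<le> head g t"
    unfolding head_def using assms
    by (intro integral_le) (auto simp: admissible_def intro!: mult_left_mono)
  have tl: "tail f s \<le> tail g s" if "s \<ge> 0" for s
    unfolding tail_def using assms that
    by (intro integral_le) (auto simp: admissible_def intro!: mult_left_mono)
  show ?thesis
    unfolding green_op_def using p_pos q_pos
    by (intro divide_right_mono add_mono mult_left_mono h tl refl_coeff_nonneg) (auto simp: t)
qed

lemma admissible_const: "admissible (\<lambda>_. k)"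
  by (rule admissible_continuous[where B = "\<bar>k\<bar>"]) auto

text \<open>The constant \<open>b\<close> solves the linear equation with right-hand side
  \<open>p * q * b\<close> but in general violates the boundary condition; correcting it by a
  multiple of \<open>exp (- p * t)\<close> leaves a fraction of \<open>b\<close>.\<close>

lemma green_op_const:
  assumes t: "t \<ge> 0"
  shows "\<exists>\<theta>. 0 \<le> \<theta> \<and> \<theta> \<le> 1 \<and> (\<forall>b. green_op (\<lambda>_. p * q * b) t = \<theta> * b)"
proof -
  have hd: "head (\<lambda>_. k) t = k * (exp (p * t) - 1) / p" for k
  proof -
    have "((\<lambda>s. exp (p * s) * k) has_integral (exp (p * t) * k / p - exp (p * 0) * k / p)) {0..t}"
      by (intro fundamental_theorem_of_calculus t)
        (use p_pos in \<open>auto intro!: derivative_eq_intros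
          simp flip: has_real_derivative_iff_has_vector_derivative\<close>)
    from integral_unique[OF this] show ?thesis
      unfolding head_def by (simp add: diff_divide_distrib right_diff_distrib)
  qed
  have tl: "tail (\<lambda>_. k) s = k * exp (- q * s) / q" for k s
  proof -
    have "((\<lambda>s. exp (- q * s) * k) has_integral (exp (- q * s) / q * k)) {s..}"
      by (intro has_integral_mult_left has_integral_exp_minus_to_infinity q_pos)
    from integral_unique[OF this] show ?thesis
      unfolding tail_def by (simp add: mult.commute)
  qed
  define \<theta> where "\<theta> = 1 - exp (- p * t) * (q - refl_coeff * p) / (p + q)"
  have "green_op (\<lambda>_. p * q * b) t = \<theta> * b" for b
  proof -
    have "exp (- p * t) * exp (p * t) = 1" "exp (q * t) * exp (- q * t) = 1"
      by (simp_all flip: exp_add)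
    moreover have "head (\<lambda>_. p * q * b) t = q * b * exp (p * t) - q * b"
      using p_pos by (simp add: hd field_simps)
    moreover have "tail (\<lambda>_. p * q * b) 0 = p * b" "tail (\<lambda>_. p * q * b) t = p * b * exp (- q * t)"
      using q_pos by (simp_all add: tl)
    moreover have "(p + q) * green_op (\<lambda>_. p * q * b) t
        = exp (- p * t) * (head (\<lambda>_. p * q * b) t + refl_coeff * tail (\<lambda>_. p * q * b) 0)
          + exp (q * t) * tail (\<lambda>_. p * q * b) t"
      using p_pos q_pos unfolding green_op_def by simp
    ultimately have "(p + q) * green_op (\<lambda>_. p * q * b) t
        = q * b - exp (- p * t) * (q * b) + exp (- p * t) * (refl_coeff * (p * b)) + p * b"
      by algebra
    also have "\<dots> = (p + q) * (\<theta> * b)"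
    proof -
      have "(p + q) * \<theta> = p + q - exp (- p * t) * (q - refl_coeff * p)"
        using p_pos q_pos unfolding \<theta>_def by (subst right_diff_distrib) simp
      then show ?thesis by algebra
    qed
    finally show ?thesis
      using p_pos q_pos by simp
  qed
  \<comment> \<open>This sign gives \<open>\<theta> \<le> 1\<close>; the bound after it gives
    \<open>0 \<le> \<theta>\<close>.\<close>
  moreover have "0 \<le> q - refl_coeff * p"
  proof -
    have "refl_coeff * p \<le> q"
      using p_pos m_pos m_le_q by (simp add: refl_coeff_def field_simps)
    then show ?thesis by simp
  qed
  moreover have "exp (- p * t) * (q - refl_coeff * p) / (p + q) \<le> 1"
  proof -
    have "exp (- p * t) * (q - refl_coeff * p) \<le> 1 * (q - refl_coeff * p)"
      using p_pos t calculation by (intro mult_right_mono) auto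
    also have "\<dots> \<le> p + q"
      unfolding mult_1_left using p_pos mult_nonneg_nonneg[OF refl_coeff_nonneg less_imp_le[OF p_pos]] by linarith
    finally show ?thesis using p_pos q_pos by simp
  qed
  ultimately show ?thesis
    using p_pos q_pos by (intro exI[of _ \<theta>]) (auto simp: \<theta>_def)
qed

text \<open>Comparison with a constant right-hand side; since only \<open>\<theta> \<le> 1\<close>
  is known, the sign of \<open>b\<close> is what gives \<open>\<theta> * b \<le> b\<close>.\<close>

lemma green_op_le:
  assumes "admissible f" and "\<And>s. s \<ge> 0 \<Longrightarrow> f s \<le> p * q * b" and "0 \<le> b" "0 \<le> t"
  shows "green_op f t \<le> b"
proof -
  obtain \<theta> where "0 \<le> \<theta>" "\<theta> \<le> 1" "green_op (\<lambda>_. p * q * b) t = \<theta> * b"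
    using green_op_const[OF \<open>0 \<le> t\<close>] by blast
  moreover have "green_op f t \<le> green_op (\<lambda>_. p * q * b) t"
    using assms by (intro green_op_mono admissible_const)
  ultimately show ?thesis
    using \<open>0 \<le> b\<close> mult_right_mono[of \<theta> 1 b] by simp
qed

lemma green_op_ge:
  assumes "admissible f" and "\<And>s. s \<ge> 0 \<Longrightarrow> p * q * - a \<le> f s" and "0 \<le> a" "0 \<le> t"
  shows "- a \<le> green_op f t"
proof -
  obtain \<theta> where "0 \<le> \<theta>" "\<theta> \<le> 1" "green_op (\<lambda>_. p * q * - a) t = \<theta> * - a"
    using green_op_const[OF \<open>0 \<le> t\<close>] by blast
  moreover have "green_op (\<lambda>_. p * q * - a) t \<le> green_op f t"
    using assms by (intro green_op_mono admissible_const)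
  ultimately show ?thesis
    using \<open>0 \<le> a\<close> mult_right_mono[of \<theta> 1 a] by simp
qed

text \<open>Dominated convergence in \<open>head\<close> and \<open>tail\<close> separately, with
  majorants \<open>exp (p * s) * B\<close> and \<open>exp (- q * s) * B\<close>.\<close>

lemma green_op_limit:
  assumes adm: "\<And>n. admissible (f n)"
    and bound: "\<And>n s. s \<ge> 0 \<Longrightarrow> \<bar>f n s\<bar> \<le> B"
    and lim: "\<And>s. s \<ge> 0 \<Longrightarrow> (\<lambda>n. f n s) \<longlonglongrightarrow> F s"
  shows "admissible F" and "t \<ge> 0 \<Longrightarrow> (\<lambda>n. green_op (f n) t) \<longlonglongrightarrow> green_op F t"
proof -
  have hd: "(\<lambda>s. exp (p * s) * F s) integrable_on {0..t} \<and> (\<lambda>n. head (f n) t) \<longlonglongrightarrow> head F t"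
    if "t \<ge> 0" for t
  proof -
    have 1: "(\<lambda>s. exp (p * s) * f n s) integrable_on {0..t}" for n
      using adm that by (auto simp: admissible_def)
    have 2: "(\<lambda>s. exp (p * s) * B) integrable_on {0..t}"
      by (intro integrable_continuous_interval continuous_intros)
    have 3: "norm (exp (p * s) * f n s) \<le> exp (p * s) * B" if "s \<in> {0..t}" for n s
      using bound[of s n] that \<open>t \<ge> 0\<close> by (auto simp: abs_mult intro!: mult_left_mono)
    have 4: "(\<lambda>n. exp (p * s) * f n s) \<longlonglongrightarrow> exp (p * s) * F s" if "s \<in> {0..t}" for s
      using that \<open>t \<ge> 0\<close> by (intro tendsto_mult_left lim) auto
    show ?thesis
      unfolding head_def using dominated_convergence[OF 1 2 3 4] by blast
  qed
  have tl: "(\<lambda>s. exp (- q * s) * F s) integrable_on {t..} \<and> (\<lambda>n. tail (f n) t) \<longlonglongrightarrow> tail F t"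
    if "t \<ge> 0" for t
  proof -
    have 1: "(\<lambda>s. exp (- q * s) * f n s) integrable_on {t..}" for n
      using adm that by (auto simp: admissible_def)
    have 2: "(\<lambda>s. exp (- q * s) * B) integrable_on {t..}"
      by (intro integrable_on_mult_left integrable_on_exp_minus_to_infinity q_pos)
    have 3: "norm (exp (- q * s) * f n s) \<le> exp (- q * s) * B" if "s \<in> {t..}" for n s
      using bound[of s n] that \<open>t \<ge> 0\<close> by (auto simp: abs_mult intro!: mult_left_mono)
    have 4: "(\<lambda>n. exp (- q * s) * f n s) \<longlonglongrightarrow> exp (- q * s) * F s" if "s \<in> {t..}" for s
      using that \<open>t \<ge> 0\<close> by (intro tendsto_mult_left lim) auto
    show ?thesis
      unfolding tail_def using dominated_convergence[OF 1 2 3 4] by blast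
  qed
  show "admissible F"
    using hd tl by (auto simp: admissible_def)
  show "(\<lambda>n. green_op (f n) t) \<longlonglongrightarrow> green_op F t" if "t \<ge> 0"
    unfolding green_op_def using hd tl that p_pos q_pos
    by (intro tendsto_intros) auto
qed

section \<open>Regularity, differential equation and boundary condition\<close>

text \<open>Moves the variable endpoint onto a compact interval, where continuity and
  differentiability of indefinite integrals apply.\<close>

lemma tail_eq:
  assumes "admissible f" "t \<ge> 0"
  shows "(\<lambda>s. exp (- q * s) * f s) integrable_on {0..t}"
    and "tail f t = tail f 0 - integral {0..t} (\<lambda>s. exp (- q * s) * f s)"
proof -
  let ?g = "\<lambda>s. exp (- q * s) * f s"
  have i0: "?g integrable_on {0..}" and it: "?g integrable_on {t..}"
    using assms by (auto simp: admissible_def)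
  show i1: "?g integrable_on {0..t}"
    using integrable_on_subinterval[OF i0, of 0 t] by simp
  have "{0..t} \<union> {t..} = {0..}" "{0..t} \<inter> {t..} = {t}"
    using \<open>t \<ge> 0\<close> by auto
  then have "integral {0..} ?g = integral {0..t} ?g + integral {t..} ?g"
    using integral_Un[OF i1 it] by simp
  then show "tail f t = tail f 0 - integral {0..t} ?g"
    by (simp add: tail_def)
qed

text \<open>First half of the regularity bootstrap: continuity is gained from integrability
  alone.\<close>

lemma continuous_green_op:
  assumes "admissible f"
  shows "continuous_on {0..} (green_op f)"
proof -
  let ?g = "\<lambda>s. exp (- q * s) * f s"
  have "continuous (at t within {0..}) (green_op f)" if t: "t \<ge> 0" for t
  proof -
    have "continuous_on {0..t + 1} (\<lambda>x. head f x)"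
      unfolding head_def using assms t
      by (intro indefinite_integral_continuous_1) (auto simp: admissible_def)
    moreover have "continuous_on {0..t + 1} (\<lambda>x. tail f 0 - integral {0..x} ?g)"
      using t
      by (intro continuous_on_diff continuous_on_const
          indefinite_integral_continuous_1[OF tail_eq(1)[OF assms]]) simp
    then have "continuous_on {0..t + 1} (\<lambda>x. tail f x)"
      by (rule continuous_on_eq) (rule tail_eq(2)[OF assms, symmetric], simp)
    ultimately have "continuous_on {0..t + 1} (\<lambda>x. green_op f x)"
      unfolding green_op_def using p_pos q_pos by (intro continuous_intros) auto
    then show ?thesis
      using t by (simp add: continuous_on_eq_continuous_within flip: within_half_line)
  qed
  then show ?thesis
    by (simp add: continuous_on_eq_continuous_within)
qed

lemma head_tail_deriv:
  assumes cont: "continuous_on {0..} f" and adm: "admissible f" and t: "t \<ge> 0"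
  shows "(head f has_real_derivative exp (p * t) * f t) (at t within {0..})"
    and "(tail f has_real_derivative - (exp (- q * t) * f t)) (at t within {0..})"
proof -
  let ?g = "\<lambda>s. exp (- q * s) * f s"
  have c: "continuous_on {0..t + 1} f"
    by (rule continuous_on_subset[OF cont]) auto
  have "((\<lambda>x. integral {0..x} (\<lambda>s. exp (p * s) * f s)) has_real_derivative exp (p * t) * f t)
          (at t within {0..t + 1})"
    using t by (intro integral_has_real_derivative continuous_intros c) auto
  then show "(head f has_real_derivative exp (p * t) * f t) (at t within {0..})"
    unfolding within_half_line[OF t] head_def .
  have "((\<lambda>x. integral {0..x} ?g) has_real_derivative ?g t) (at t within {0..t + 1})"
    using t by (intro integral_has_real_derivative continuous_intros c) auto
  then have "((\<lambda>x. tail f 0 - integral {0..x} ?g) has_real_derivative - ?g t) (at t within {0..})"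
    unfolding within_half_line[OF t] by (auto intro!: derivative_eq_intros)
  then show "(tail f has_real_derivative - ?g t) (at t within {0..})"
  proof (rule has_field_derivative_transform_within[where d = 1])
    show "tail f 0 - integral {0..x} ?g = tail f x" if "x \<in> {0..}" for x
      using that by (intro tail_eq(2)[OF adm, symmetric]) simp
  qed (use t in auto)
qed

text \<open>In the first derivative the contributions of \<open>f\<close> from \<open>head\<close>
  and \<open>tail\<close> cancel, so a second derivative exists without differentiating
  \<open>f\<close>; there they add up to \<open>- f t\<close>.\<close>

lemma green_op_deriv:
  assumes cont: "continuous_on {0..} f" and adm: "admissible f" and t: "t \<ge> 0"
  shows "(green_op f has_real_derivative green_deriv f t) (at t within {0..})"
    and "(green_deriv f has_real_derivative (q - p) * green_deriv f t + p * q * green_op f t - f t)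
           (at t within {0..})"
proof -
  note d = head_tail_deriv[OF assms]
  have e: "exp (- p * t) * (exp (p * t) * x) = x" "exp (q * t) * (exp (- q * t) * x) = x" for x
    by (simp_all flip: mult.assoc exp_add)
  let ?R = "refl_coeff * tail f 0"
  have "((\<lambda>x. exp (- p * x) * (head f x + ?R)) has_real_derivative
      exp (- p * t) * (exp (p * t) * f t) + - p * exp (- p * t) * (head f t + ?R)) (at t within {0..})"
    by (rule DERIV_mult') (auto intro!: derivative_eq_intros d)
  then have d1: "((\<lambda>x. exp (- p * x) * (head f x + ?R)) has_real_derivative
      f t + - p * exp (- p * t) * (head f t + ?R)) (at t within {0..})"
    unfolding e .
  have "((\<lambda>x. exp (q * x) * tail f x) has_real_derivative
      exp (q * t) * - (exp (- q * t) * f t) + q * exp (q * t) * tail f t) (at t within {0..})"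
    by (rule DERIV_mult'[OF _ d(2)]) (auto intro!: derivative_eq_intros d)
  then have d2: "((\<lambda>x. exp (q * x) * tail f x) has_real_derivative
      - f t + q * exp (q * t) * tail f t) (at t within {0..})"
    unfolding mult_minus_right e .
  have "((\<lambda>x. (exp (- p * x) * (head f x + ?R) + exp (q * x) * tail f x) / (p + q)) has_real_derivative
      ((f t + - p * exp (- p * t) * (head f t + ?R)) + (- f t + q * exp (q * t) * tail f t)) / (p + q))
      (at t within {0..})"
    by (intro DERIV_cdivide DERIV_add d1 d2)
  then show "(green_op f has_real_derivative green_deriv f t) (at t within {0..})"
    unfolding green_op_def[abs_def] green_deriv_def by simp
  have "((\<lambda>x. (- p * (exp (- p * x) * (head f x + ?R)) + q * (exp (q * x) * tail f x)) / (p + q))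
      has_real_derivative
      (- p * (f t + - p * exp (- p * t) * (head f t + ?R)) +
        q * (- f t + q * exp (q * t) * tail f t)) / (p + q)) (at t within {0..})"
    by (intro DERIV_cdivide DERIV_add DERIV_cmult d1 d2)
  moreover have "(- p * (f t + - p * exp (- p * t) * (head f t + ?R)) +
        q * (- f t + q * exp (q * t) * tail f t)) / (p + q)
      = (q - p) * green_deriv f t + p * q * green_op f t - f t"
  proof -
    have pq: "p + q \<noteq> 0"
      using p_pos q_pos by linarith
    let ?X = "exp (- p * t) * (head f t + ?R)" and ?Y = "exp (q * t) * tail f t"
    \<comment> \<open>Apart from the terms in \<open>f t\<close>, this says that \<open>- p\<close>
      and \<open>q\<close> are the roots of \<open>r\<^sup>2 = (q - p) * r + p * q\<close>.\<close>
    have "- p * (f t + - p * ?X) + q * (- f t + q * ?Y)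
        = (q - p) * (- p * ?X + q * ?Y) + p * q * (?X + ?Y) - (p + q) * f t"
      by algebra
    moreover have "((q - p) * U + p * q * V - (p + q) * F) / (p + q)
        = (q - p) * (U / (p + q)) + p * q * (V / (p + q)) - F" for U V F
      using pq by (simp add: add_divide_distrib diff_divide_distrib)
    ultimately have "(- p * (f t + - p * ?X) + q * (- f t + q * ?Y)) / (p + q)
        = (q - p) * ((- p * ?X + q * ?Y) / (p + q)) + p * q * ((?X + ?Y) / (p + q)) - f t"
      by (simp only:)
    then show ?thesis
      unfolding green_deriv_def green_op_def mult.assoc .
  qed
  ultimately show "(green_deriv f has_real_derivative
      (q - p) * green_deriv f t + p * q * green_op f t - f t) (at t within {0..})"
    unfolding green_deriv_def[abs_def] mult.assoc by simp
qed

lemma green_boundary: "green_deriv f 0 = m * green_op f 0"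
proof -
  have "head f 0 = 0"
    by (simp add: head_def)
  moreover have "refl_coeff * (p + m) = q - m"
    using p_pos m_pos by (simp add: refl_coeff_def)
  then have "q - p * refl_coeff = m * (refl_coeff + 1)"
    by (simp add: algebra_simps)
  then have "(q - p * refl_coeff) * tail f 0 / (p + q) = m * (refl_coeff + 1) * tail f 0 / (p + q)"
    by simp
  ultimately show ?thesis
    by (simp add: green_deriv_def green_op_def algebra_simps)
qed

end

section \<open>Decay of bounded solutions\<close>

text \<open>The integrating factor gives \<open>(z * exp)' = - f * exp\<close>, so l'Hospital's rule
  for \<open>(z * exp) / exp\<close> transfers the limit of \<open>- f\<close> to
  \<open>z\<close>.\<close>

lemma tendsto_zero_forced_decay:
  fixes z f :: "real \<Rightarrow> real"
  assumes der: "\<And>t. t > 0 \<Longrightarrow> (z has_real_derivative - z t - f t) (at t)"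
    and f: "(f \<longlongrightarrow> 0) at_top"
  shows "(z \<longlongrightarrow> 0) at_top"
proof -
  have "((\<lambda>t. (z t * exp t) / exp t) \<longlongrightarrow> 0) at_top"
  proof (rule lhospital_at_top_at_top[where f' = "\<lambda>t. - f t * exp t" and g' = exp])
    have "((\<lambda>t. z t * exp t) has_real_derivative - f t * exp t) (at t)" if "t > 0" for t
      using DERIV_mult'[OF der[OF that] DERIV_exp] by (simp add: algebra_simps)
    then show "eventually (\<lambda>t. ((\<lambda>t. z t * exp t) has_real_derivative - f t * exp t) (at t)) at_top"
      by (rule eventually_mono[OF eventually_gt_at_top])
    show "((\<lambda>t. - f t * exp t / exp t) \<longlongrightarrow> 0) at_top"
      using tendsto_minus[OF f] by simp
  qed (simp_all add: exp_at_top)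
  then show ?thesis by simp
qed

text \<open>Once \<open>z < m * e\<close>, the function \<open>(w + e) * exp (- m * x)\<close> is
  strictly decreasing. Boundedness of \<open>w\<close> makes it tend to 0, so it is
  positive.\<close>

lemma eventually_gt_bounded_unstable:
  fixes w z :: "real \<Rightarrow> real"
  assumes "m > 0" and der: "\<And>t. t > 0 \<Longrightarrow> (w has_real_derivative m * w t + z t) (at t)"
    and z: "(z \<longlongrightarrow> 0) at_top" and bound: "\<And>t. t > 0 \<Longrightarrow> \<bar>w t\<bar> \<le> B" and "e > 0"
  shows "eventually (\<lambda>t. - e < w t) at_top"
proof -
  have "eventually (\<lambda>t. z t < m * e) at_top"
    using z \<open>m > 0\<close> \<open>e > 0\<close> by (intro order_tendstoD(2)[OF z]) auto
  then obtain T where T: "\<And>t. t \<ge> T \<Longrightarrow> z t < m * e"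
    by (auto simp: eventually_at_top_linorder)
  have "- e < w t" if t: "t > max 0 T" for t
  proof -
    let ?g = "\<lambda>x. (w x + e) * exp (- m * x)"
    have "0 < ?g t"
    proof (rule DERIV_neg_imp_decreasing_at_top[where f = ?g])
      fix x assume "x \<ge> t"
      then have x: "x > 0" "x \<ge> T" using t by auto
      have "(?g has_real_derivative (w x + e) * (- m * exp (- m * x)) + (m * w x + z x) * exp (- m * x)) (at x)"
        by (rule DERIV_mult') (auto intro!: derivative_eq_intros der x)
      also have "(w x + e) * (- m * exp (- m * x)) + (m * w x + z x) * exp (- m * x)
          = (z x - m * e) * exp (- m * x)"
        by (simp add: algebra_simps)
      finally have "(?g has_real_derivative (z x - m * e) * exp (- m * x)) (at x)" .
      moreover have "(z x - m * e) * exp (- m * x) < 0"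
        using T[OF x(2)] by (intro mult_neg_pos) auto
      ultimately show "\<exists>y. (?g has_real_derivative y) (at x) \<and> y < 0" by (intro exI conjI)
    next
      have lim: "((\<lambda>x. (B + e) * exp (- m * x)) \<longlongrightarrow> 0) at_top"
      proof -
        have "((\<lambda>x. exp (- (m * x))) \<longlongrightarrow> 0) at_top"
        proof (rule filterlim_compose[OF exp_at_bot])
          show "filterlim (\<lambda>x. - (m * x)) at_bot at_top"
            unfolding filterlim_uminus_at_bot minus_minus
            by (rule filterlim_tendsto_pos_mult_at_top[OF tendsto_const \<open>m > 0\<close> filterlim_ident])
        qed
        from tendsto_mult_right_zero[OF this] show ?thesis by simp
      qed
      show "(?g \<longlongrightarrow> 0) at_top"
      proof (rule Lim_null_comparison[OF _ lim])
        show "eventually (\<lambda>x. norm (?g x) \<le> (B + e) * exp (- m * x)) at_top"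
          using eventually_gt_at_top[of 0]
        proof eventually_elim
          case (elim x)
          show ?case
            using bound[OF elim] \<open>e > 0\<close> by (auto simp: abs_mult intro!: mult_right_mono)
        qed
      qed
    qed
    then have "0 < w t + e"
      by (rule zero_less_mult_pos2) simp
    then show ?thesis by simp
  qed
  then show ?thesis
    by (rule eventually_mono[OF eventually_gt_at_top])
qed

text \<open>By linearity the one-sided estimate applies to both \<open>w\<close> and
  \<open>- w\<close>.\<close>

lemma tendsto_zero_bounded_unstable:
  fixes w z :: "real \<Rightarrow> real"
  assumes "m > 0" and der: "\<And>t. t > 0 \<Longrightarrow> (w has_real_derivative m * w t + z t) (at t)"
    and z: "(z \<longlongrightarrow> 0) at_top" and bound: "\<And>t. t > 0 \<Longrightarrow> \<bar>w t\<bar> \<le> B"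
  shows "(w \<longlongrightarrow> 0) at_top"
proof (rule tendstoI)
  fix e :: real assume "e > 0"
  have "eventually (\<lambda>t. - e < w t) at_top"
    by (rule eventually_gt_bounded_unstable[OF assms \<open>e > 0\<close>])
  moreover have "eventually (\<lambda>t. - e < - w t) at_top"
  proof (rule eventually_gt_bounded_unstable[OF \<open>m > 0\<close> _ _ _ \<open>e > 0\<close>])
    show "((\<lambda>t. - w t) has_real_derivative m * - w t + - z t) (at t)" if "t > 0" for t
      using DERIV_minus[OF der[OF that]] by simp
    show "((\<lambda>t. - z t) \<longlongrightarrow> 0) at_top"
      using tendsto_minus[OF z] by simp
  qed (use bound in auto)
  ultimately show "eventually (\<lambda>t. dist (w t) 0 < e) at_top"
    by eventually_elim (simp add: dist_real_def abs_less_iff)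
qed

section \<open>Existence\<close>

text \<open>Of \<open>lam * h1\<close> only continuity, decay and two bounds matter, so the forcing
  is abstracted to \<open>h\<close>. The derivative given for \<open>v\<close> is the equation
  solved for \<open>w''\<close>.\<close>

lemma quadratic_bvp_solution:
  fixes m :: real and h :: "real \<Rightarrow> real"
  assumes m: "m > 0" and cont: "continuous_on {0..} h" and h0: "(h \<longlongrightarrow> 0) at_top"
    and upper: "\<And>t. t \<ge> 0 \<Longrightarrow> h t \<le> m / 2" and lower: "\<And>t. t \<ge> 0 \<Longrightarrow> - B \<le> h t"
  shows "\<exists>w v. (\<forall>t\<ge>0. (w has_real_derivative v t) (at t within {0..})) \<and>
    (\<forall>t\<ge>0. (v has_real_derivative
        (m - 1) * v t + m * w t - m / 2 * exp (- t) * (w t)\<^sup>2 - h t) (at t within {0..})) \<and>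
    v 0 = m * w 0 \<and> (w \<longlongrightarrow> 0) at_top"
proof -
  \<comment> \<open>Chosen so that \<open>- (m * A) = - \<bar>B\<bar>\<close> lies below
    \<open>h\<close>. The same \<open>A\<close> bounds the subsolution and fixes the shift
    \<open>m * A\<close>.\<close>
  define A where "A = \<bar>B\<bar> / m"
  have A: "A \<ge> 0" and hA: "\<And>t. t \<ge> 0 \<Longrightarrow> - (m * A) \<le> h t"
    using m lower by (force simp: A_def)+
  \<comment> \<open>\<open>q\<close> and \<open>- p\<close> are the roots of \<open>r\<^sup>2 - (m - 1) * r - m * (1 + A)\<close>.\<close>
  define D where "D = (m - 1)\<^sup>2 + 4 * (m * (1 + A))"
  define q where "q = ((m - 1) + sqrt D) / 2"
  define p where "p = q - (m - 1)"
  \<comment> \<open>Because \<open>(m - 1)\<^sup>2 + 4 * m = (m + 1)\<^sup>2\<close> and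
    \<open>A \<ge> 0\<close>; it yields \<open>m \<le> q\<close> and even
    \<open>1 \<le> p\<close>.\<close>
  have "(m + 1)\<^sup>2 \<le> D"
    using m A by (simp add: D_def power2_eq_square algebra_simps)
  then have "m + 1 \<le> sqrt D"
    by (rule real_le_rsqrt)
  then have q: "m \<le> q" and p: "0 < p"
    by (auto simp: q_def p_def)
  have "(sqrt D)\<^sup>2 = D"
    using m A by (intro real_sqrt_pow2) (simp add: D_def)
  moreover have "p * q = ((sqrt D)\<^sup>2 - (m - 1)\<^sup>2) / 4"
    by (simp add: p_def q_def field_simps power2_eq_square)
  ultimately have pq: "p * q = m * (1 + A)"
    by (simp add: D_def)
  interpret green p q m
    using p m q by unfold_locales
  \<comment> \<open>The right-hand side after the shift. As \<open>q - p = m - 1\<close> and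
    \<open>p * q = m * (1 + A)\<close>, the shift cancels at a fixed point of
    \<open>green_op\<close> composed with \<open>\<Phi>\<close>.\<close>
  define \<Phi> where "\<Phi> w t = m / 2 * exp (- t) * (w t)\<^sup>2 + m * A * w t + h t" for w :: "real \<Rightarrow> real" and t
  \<comment> \<open>The difference has the factor \<open>exp (- t) * (u t + w t) / 2 + A\<close>,
    nonnegative since both values are at least \<open>- A\<close> and
    \<open>exp (- t) \<le> 1\<close>.\<close>
  have \<Phi>_mono: "\<Phi> u t \<le> \<Phi> w t" if "- A \<le> u t" "u t \<le> w t" "t \<ge> 0" for u w t
  proof -
    have "exp (- t) * (- (2 * A)) \<le> exp (- t) * (u t + w t)"
      using that by (intro mult_left_mono) auto
    moreover have "exp (- t) * A \<le> A"
      using that A by (simp add: mult_left_le_one_le)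
    ultimately have "0 \<le> exp (- t) * (u t + w t) / 2 + A"
      by simp
    then have "0 \<le> m * (w t - u t) * (exp (- t) * (u t + w t) / 2 + A)"
      using m that by (intro mult_nonneg_nonneg) auto
    also have "\<dots> = \<Phi> w t - \<Phi> u t"
      by (simp add: \<Phi>_def power2_eq_square field_simps)
    finally show ?thesis by simp
  qed
  define trapped where "trapped w \<longleftrightarrow> (\<forall>t\<ge>0. - A \<le> w t \<and> w t \<le> 1)" for w :: "real \<Rightarrow> real"
  \<comment> \<open>The value at the constant 1 is at most \<open>m / 2 + m * A + m / 2\<close>,
    which is \<open>p * q\<close>; here the upper bound on the forcing enters.\<close>
  have \<Phi>_upper: "\<Phi> w t \<le> p * q * 1" if "trapped w" "t \<ge> 0" for w t
  proof -
    have "\<Phi> w t \<le> \<Phi> (\<lambda>_. 1) t"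
      using that by (intro \<Phi>_mono) (auto simp: trapped_def)
    moreover have "m / 2 * exp (- t) \<le> m / 2"
      using m that by simp
    ultimately show ?thesis
      using upper[OF \<open>t \<ge> 0\<close>] unfolding \<Phi>_def pq by (simp add: algebra_simps)
  qed
  \<comment> \<open>At the constant \<open>- A\<close> the square is discarded, leaving at least
    \<open>- m * A\<^sup>2 - m * A\<close>, which is \<open>p * q * - A\<close>.\<close>
  have \<Phi>_lower: "p * q * - A \<le> \<Phi> w t" if "trapped w" "t \<ge> 0" for w t
  proof -
    have "\<Phi> (\<lambda>_. - A) t \<le> \<Phi> w t"
      using that by (intro \<Phi>_mono) (auto simp: trapped_def)
    moreover have "0 \<le> m / 2 * exp (- t) * A\<^sup>2"
      using m by simp
    ultimately show ?thesis
      using hA[OF \<open>t \<ge> 0\<close>] unfolding \<Phi>_def pq by (simp add: algebra_simps)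
  qed
  have \<Phi>_bound: "\<bar>\<Phi> w t\<bar> \<le> p * q * (1 + A)" if "trapped w" "t \<ge> 0" for w t
  proof -
    have "0 \<le> p * q * A" "0 \<le> p * q"
      using p q m A by auto
    then show ?thesis
      using \<Phi>_upper[OF that] \<Phi>_lower[OF that] by (simp add: abs_le_iff algebra_simps)
  qed
  have \<Phi>_cont: "continuous_on {0..} (\<Phi> w)" if "continuous_on {0..} w" for w
    unfolding \<Phi>_def[abs_def] by (intro continuous_intros that cont)
  have \<Phi>_adm: "admissible (\<Phi> w)" if "continuous_on {0..} w" "trapped w" for w
    using \<Phi>_bound[OF that(2)] by (intro admissible_continuous \<Phi>_cont that)
  have trapped_green: "trapped (green_op (\<Phi> w))" if "admissible (\<Phi> w)" "trapped w" for w
    unfolding trapped_def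
    using green_op_le[OF that(1) \<Phi>_upper[OF that(2)]] green_op_ge[OF that(1) \<Phi>_lower[OF that(2)]] A
    by auto

  define W where "W n = ((\<lambda>w. green_op (\<Phi> w)) ^^ n) (\<lambda>_. 1)" for n
  have W_Suc: "W (Suc n) = green_op (\<Phi> (W n))" for n
    by (simp add: W_def)
  have W: "continuous_on {0..} (W n) \<and> trapped (W n)" for n
  proof (induction n)
    case 0
    show ?case using A by (simp add: W_def trapped_def)
  next
    case (Suc n)
    then show ?case
      unfolding W_Suc by (intro conjI continuous_green_op trapped_green \<Phi>_adm) auto
  qed
  have W_range: "- A \<le> W n t" "W n t \<le> 1" if "t \<ge> 0" for n t
    using W[of n] that by (auto simp: trapped_def)
  have W_adm: "admissible (\<Phi> (W n))" for n
    using W by (intro \<Phi>_adm) auto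
  \<comment> \<open>The first step decreases because every iterate is trapped below 1; monotonicity
    of \<open>\<Phi>\<close> and \<open>green_op\<close> propagates this.\<close>
  have W_dec: "\<forall>t\<ge>0. W (Suc n) t \<le> W n t" for n
  proof (induction n)
    case 0
    show ?case using W_range(2)[of _ 1] by (simp add: W_def)
  next
    case (Suc n)
    have "green_op (\<Phi> (W (Suc n))) t \<le> green_op (\<Phi> (W n)) t" if "t \<ge> 0" for t
      using Suc W_range that by (intro green_op_mono W_adm \<Phi>_mono) auto
    then show ?case by (simp add: W_Suc)
  qed
  have "\<exists>l. (\<lambda>n. W n t) \<longlonglongrightarrow> l" if "t \<ge> 0" for t
  proof -
    have "decseq (\<lambda>n. W n t)"
      using W_dec that by (auto simp: decseq_Suc_iff)
    then show ?thesis
      using W_range(1)[OF that] by (metis decseq_convergent)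
  qed
  then obtain w where w: "\<And>t. t \<ge> 0 \<Longrightarrow> (\<lambda>n. W n t) \<longlonglongrightarrow> w t"
    by metis
  have trapped_w: "trapped w"
    unfolding trapped_def
    using LIMSEQ_le_const[OF w] LIMSEQ_le_const2[OF w] W_range by metis
  have "(\<lambda>n. \<Phi> (W n) t) \<longlonglongrightarrow> \<Phi> w t" if "t \<ge> 0" for t
    unfolding \<Phi>_def using w[OF that] by (intro tendsto_intros)
  moreover have "\<bar>\<Phi> (W n) t\<bar> \<le> p * q * (1 + A)" if "t \<ge> 0" for n t
    using W that by (intro \<Phi>_bound) auto
  ultimately have adm_lim: "admissible (\<Phi> w)"
    and lim: "\<And>t. t \<ge> 0 \<Longrightarrow> (\<lambda>n. green_op (\<Phi> (W n)) t) \<longlonglongrightarrow> green_op (\<Phi> w) t"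
    using green_op_limit[where f = "\<lambda>n. \<Phi> (W n)" and F = "\<Phi> w", OF W_adm] by blast+
  \<comment> \<open>The limit \<open>w\<close> is controlled only on \<open>{0..}\<close> and not
    yet known to be continuous. Its representative \<open>u\<close> is continuous, hence so is
    \<open>\<Phi> w\<close> on \<open>{0..}\<close>, and then \<open>u\<close> is twice
    differentiable there.\<close>
  define u where "u = green_op (\<Phi> w)"
  have u_eq: "u t = w t" if "t \<ge> 0" for t
  proof (rule LIMSEQ_unique)
    show "(\<lambda>n. W (Suc n) t) \<longlonglongrightarrow> u t"
      using lim[OF that] by (simp add: W_Suc u_def)
    show "(\<lambda>n. W (Suc n) t) \<longlonglongrightarrow> w t"
      by (rule LIMSEQ_Suc[OF w[OF that]])
  qed
  have u_cont: "continuous_on {0..} u"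
    unfolding u_def by (rule continuous_green_op[OF adm_lim])
  then have "continuous_on {0..} (\<Phi> u)"
    by (rule \<Phi>_cont)
  then have cont_\<Phi>: "continuous_on {0..} (\<Phi> w)"
    by (rule continuous_on_eq) (simp add: \<Phi>_def u_eq)
  define v where "v = green_deriv (\<Phi> w)"
  have du: "(u has_real_derivative v t) (at t within {0..})" if "t \<ge> 0" for t
    unfolding u_def v_def by (rule green_op_deriv(1)[OF cont_\<Phi> adm_lim that])
  have dv: "(v has_real_derivative
      (m - 1) * v t + m * u t - m / 2 * exp (- t) * (u t)\<^sup>2 - h t) (at t within {0..})"
    if "t \<ge> 0" for t
  proof -
    have "(q - p) * v t + p * q * u t - \<Phi> w t
        = (m - 1) * v t + m * u t - m / 2 * exp (- t) * (u t)\<^sup>2 - h t"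
      using u_eq[OF that] unfolding pq by (simp add: \<Phi>_def p_def algebra_simps)
    then show ?thesis
      using green_op_deriv(2)[OF cont_\<Phi> adm_lim that] by (simp add: u_def v_def)
  qed
  have bdd: "\<bar>u t\<bar> \<le> 1 + A" if "t \<ge> 0" for t
    using trapped_w A that u_eq[OF that] by (auto simp: trapped_def abs_le_iff intro: order_trans)
  have within: "at t within {0..} = at t" if "t > 0" for t :: real
    using that by (intro at_within_interior) simp
  have forcing: "((\<lambda>t. m / 2 * exp (- t) * (u t)\<^sup>2 + h t) \<longlongrightarrow> 0) at_top"
  proof -
    have e: "((\<lambda>t::real. exp (- t)) \<longlongrightarrow> 0) at_top"
      by (intro filterlim_compose[OF exp_at_bot] filterlim_uminus_at_bot_at_top)
    have "((\<lambda>t. m / 2 * (1 + A)\<^sup>2 * exp (- t)) \<longlongrightarrow> 0) at_top"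
      by (rule tendsto_mult_right_zero[OF e])
    then have "((\<lambda>t. m / 2 * exp (- t) * (u t)\<^sup>2) \<longlongrightarrow> 0) at_top"
    proof (rule Lim_null_comparison[rotated])
      show "eventually (\<lambda>t. norm (m / 2 * exp (- t) * (u t)\<^sup>2) \<le> m / 2 * (1 + A)\<^sup>2 * exp (- t)) at_top"
        using eventually_ge_at_top[of 0]
      proof eventually_elim
        case (elim t)
        have "(u t)\<^sup>2 \<le> (1 + A)\<^sup>2"
          using bdd[OF elim] by (rule abs_le_square_iff[THEN iffD1, OF order_trans]) simp
        then show ?case
          using m by (simp add: abs_mult mult_ac)
      qed
    qed
    from tendsto_add[OF this h0] show ?thesis by simp
  qed
  \<comment> \<open>The operator \<open>- u'' + (m - 1) * u' + m * u\<close> has characteristic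
    roots \<open>- 1\<close> and \<open>m\<close>: \<open>z = v - m * u\<close> satisfies the stable
    equation \<open>z' = - z - f\<close>, with \<open>f\<close> the forcing, and \<open>u\<close>
    the unstable one \<open>u' = m * u + z\<close>.\<close>
  have "((\<lambda>t. v t - m * u t) \<longlongrightarrow> 0) at_top"
  proof (rule tendsto_zero_forced_decay[OF _ forcing])
    fix t :: real assume t: "t > 0"
    note d = du[OF less_imp_le[OF t], unfolded within[OF t]] dv[OF less_imp_le[OF t], unfolded within[OF t]]
    show "((\<lambda>t. v t - m * u t) has_real_derivative
        - (v t - m * u t) - (m / 2 * exp (- t) * (u t)\<^sup>2 + h t)) (at t)"
      using DERIV_diff[OF d(2) DERIV_cmult[OF d(1), of m]] t by (simp add: algebra_simps)
  qed
  then have "(u \<longlongrightarrow> 0) at_top"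
  proof (rule tendsto_zero_bounded_unstable[OF m, rotated])
    show "(u has_real_derivative m * u t + (v t - m * u t)) (at t)" if "t > 0" for t
      using du[of t] that by (simp add: within)
    show "\<bar>u t\<bar> \<le> 1 + A" if "t > 0" for t
      using bdd that by simp
  qed
  moreover have "v 0 = m * u 0"
    unfolding u_def v_def by (rule green_boundary)
  ultimately show ?thesis
    using du dv by blast
qed

section \<open>The forcing term of the boundary value problem\<close>

text \<open>For \<open>N \<le> 3\<close> the exponential factor is at most 1 on the half-line, so
  everything reduces to the primitive \<open>G\<close> of \<open>g\<close>, which is continuous on
  \<open>{0..1}\<close> with \<open>G 0 = 0\<close>.\<close>

lemma h1_properties:
  assumes N: "N \<in> {2, 3}" and g: "set_integrable lebesgue {0..1} g"
  shows "continuous_on {0..} (h1 N g)" and "(h1 N g \<longlongrightarrow> 0) at_top"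
    and "\<exists>B. \<forall>t\<ge>0. \<bar>h1 N g t\<bar> \<le> B"
proof -
  define G where "G x = integral {0..x} g" for x
  have gi: "g integrable_on {0..1}"
    using g by (rule set_lebesgue_integral_eq_integral)
  have G_cont: "continuous_on {0..1} G"
    unfolding G_def[abs_def] by (rule indefinite_integral_continuous_1[OF gi])
  have h1_eq: "h1 N g t = exp ((real N - 3) * t) * G (exp (- t))" if "t \<ge> 0" for t
  proof -
    have "set_integrable lebesgue {0..exp (- t)} g"
      using that by (intro set_integrable_subset[OF g]) auto
    then show ?thesis
      by (simp add: h1_def G_def set_lebesgue_integral_eq_integral)
  qed
  have "continuous_on {0..} (\<lambda>t. exp ((real N - 3) * t) * G (exp (- t)))"
    by (intro continuous_intros continuous_on_compose2[OF G_cont]) auto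
  then show "continuous_on {0..} (h1 N g)"
    by (rule continuous_on_eq) (simp add: h1_eq)
  have le: "\<bar>h1 N g t\<bar> \<le> \<bar>G (exp (- t))\<bar>" if "t \<ge> 0" for t
  proof -
    have "(real N - 3) * t \<le> 0"
      using N that by auto
    then show ?thesis
      by (simp add: h1_eq that abs_mult mult_left_le_one_le)
  qed
  have "compact (G ` {0..1})"
    by (intro compact_continuous_image G_cont compact_Icc)
  then obtain B where B: "\<And>x. x \<in> {0..1} \<Longrightarrow> \<bar>G x\<bar> \<le> B"
    using compact_imp_bounded by (force simp: bounded_iff)
  then have "\<bar>h1 N g t\<bar> \<le> B" if "t \<ge> 0" for t
    using that by (intro order_trans[OF le B]) auto
  then show "\<exists>B. \<forall>t\<ge>0. \<bar>h1 N g t\<bar> \<le> B" by blast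
  have "(G \<longlongrightarrow> G 0) (at 0 within {0..1})"
    using G_cont by (simp add: continuous_on_def)
  then have "(G \<longlongrightarrow> 0) (at 0 within {0..1})"
    by (simp add: G_def)
  moreover have "filterlim (\<lambda>t::real. exp (- t)) (at 0 within {0..1}) at_top"
    unfolding filterlim_at
  proof
    show "eventually (\<lambda>t::real. exp (- t) \<in> {0..1} \<and> exp (- t) \<noteq> 0) at_top"
      using eventually_ge_at_top[of 0] by eventually_elim auto
    show "((\<lambda>t::real. exp (- t)) \<longlongrightarrow> 0) at_top"
      by (intro filterlim_compose[OF exp_at_bot] filterlim_uminus_at_bot_at_top)
  qed
  ultimately have "((\<lambda>t. G (exp (- t))) \<longlongrightarrow> 0) at_top"
    by (rule filterlim_compose)
  then have "((\<lambda>t. \<bar>G (exp (- t))\<bar>) \<longlongrightarrow> 0) at_top"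
    by (rule tendsto_rabs_zero)
  then show "(h1 N g \<longlongrightarrow> 0) at_top"
  proof (rule Lim_null_comparison[rotated])
    show "eventually (\<lambda>t. norm (h1 N g t) \<le> \<bar>G (exp (- t))\<bar>) at_top"
      by (rule eventually_mono[OF eventually_ge_at_top[of 0]]) (simp add: le)
  qed
qed

theorem theorem5p5:
  fixes N :: nat and g :: "real \<Rightarrow> real" and lam :: real
  assumes "N \<in> {2, 3}"
    and "set_integrable lebesgue {0..1} g"
    and "\<And>t. t > 0 \<Longrightarrow> lam * h1 N g t \<le> (real N - 1) / 2"
  shows "\<exists>w. is_solution N g lam w"
proof -
  define m where "m = real N - 1"
  define h where "h t = lam * h1 N g t" for t
  have m: "m > 0"
    using assms(1) by (auto simp: m_def)
  note h1 = h1_properties[OF assms(1,2)]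
  have cont: "continuous_on {0..} h"
    unfolding h_def[abs_def] by (intro continuous_intros h1)
  have h0: "(h \<longlongrightarrow> 0) at_top"
    unfolding h_def[abs_def] by (rule tendsto_mult_right_zero[OF h1(2)])
  \<comment> \<open>The hypothesis covers only \<open>t > 0\<close>; continuity extends it to the
    closure, which contains 0.\<close>
  have upper: "h t \<le> m / 2" if "t \<ge> 0" for t
  proof (rule continuous_le_on_closure[where f = h and S = "{0<..}"])
    show "continuous_on (closure {0<..}) h" using cont by simp
  qed (use assms(3) that in \<open>auto simp: h_def m_def\<close>)
  obtain B where B: "\<And>t. t \<ge> 0 \<Longrightarrow> \<bar>h1 N g t\<bar> \<le> B"
    using h1(3) by blast
  have lower: "- (\<bar>lam\<bar> * B) \<le> h t" if "t \<ge> 0" for t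
  proof -
    have "\<bar>h t\<bar> \<le> \<bar>lam\<bar> * B"
      unfolding h_def abs_mult by (intro mult_left_mono B that) auto
    then show ?thesis by linarith
  qed
  obtain w v where sol: "\<forall>t\<ge>0. (w has_real_derivative v t) (at t within {0..})"
    "\<forall>t\<ge>0. (v has_real_derivative
        (m - 1) * v t + m * w t - m / 2 * exp (- t) * (w t)\<^sup>2 - h t) (at t within {0..})"
    "v 0 = m * w 0" "(w \<longlongrightarrow> 0) at_top"
    using quadratic_bvp_solution[OF m cont h0 upper lower] by blast
  \<comment> \<open>The equation solved for the second derivative, so that continuity of
    \<open>w''\<close> follows from that of \<open>w\<close>, \<open>v\<close> and
    \<open>h\<close>.\<close>
  define w'' where "w'' t = (m - 1) * v t + m * w t - m / 2 * exp (- t) * (w t)\<^sup>2 - h t" for t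
  have "continuous_on {0..} w" "continuous_on {0..} v"
    using sol(1,2) by (auto intro!: DERIV_continuous_on)
  then have "continuous_on {0..} w''"
    unfolding w''_def[abs_def] by (intro continuous_intros cont)
  then show ?thesis
    unfolding is_solution_def using sol
    by (intro exI[of _ w] exI[of _ v] exI[of _ w'']) (auto simp: w''_def h_def m_def)
qed

end
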